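(* Let $c_0<1$ and $f\in\mathcal{M}^{-1}(L_c)$, with $f(x)=\frac{1}{2\pi i}\int_c f^*(s)x^{-s}\,ds$, $f^*\in L_1(c)$. Then the transformation $$(Ff)(z)=2\int_0^\infty x^{z/2}K_z(2\sqrt{x})f(x)\,dx$$ is well-defined and $(Ff)(z)$ is analytic in the half-plane $\operatorname{Re} z>c_0-1$. Further, $$(Ff)(z)=\frac{1}{2\pi i}\int_{c_0-i\infty}^{c_0+i\infty}\Gamma(1-s+z)\Gamma(1-s)f^*(s)\,ds,\qquad \operatorname{Re} z>c_0-1,$$ and, for each fixed value of $\operatorname{Re} z>c_0-1$, the operator $F:\mathcal{M}^{-1}(L_c)\to L_1(\operatorname{Re} z-i\infty,\operatorname{Re} z+i\infty)$ is bounded, with norm satisfying the estimate $$\|F\|\le \Gamma(1-c_0)\int_{-\infty}^\infty|\Gamma(1-c_0+\operatorname{Re} z+i\tau)|\,d\tau.$$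
   Context: $K_z$ is the modified Bessel function of the second kind (Macdonald function) of complex order $z$; $\Gamma$ is Euler's gamma function. For $c_0\in\mathbb{R}$ let $c=\{s\in\mathbb{C}:\operatorname{Re} s=c_0\}$ be the vertical line. $\mathcal{M}^{-1}(L_c)$ is the space of functions $f(x)$, $x\in\mathbb{R}_+=(0,\infty)$, representable as inverse Mellin transforms $f(x)=\frac{1}{2\pi i}\int_c f^*(s)x^{-s}\,ds$ of functions $f^*\in L_1(c)$ integrable on the line $c$, with norm $\|f\|_{\mathcal{M}^{-1}(L_c)}=\frac{1}{2\pi}\int_{-\infty}^{+\infty}|f^*(c_0+it)|\,dt$. The norm on $L_1(\operatorname{Re} z-i\infty,\operatorname{Re} z+i\infty)$ is $\|G\|_1=\int_{-\infty}^\infty|G(\operatorname{Re} z+i\tau)|\,d\tau$. *)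

theory Defs
  imports "HOL-Complex_Analysis.Complex_Analysis"
begin

text \<open>
  Integration over the upward vertical line \<open>Re s = c0\<close>, parametrised by \<open>s = c0 + i t\<close>, so
  that \<open>ds = i dt\<close>. All integrals are Lebesgue integrals.
\<close>

definition vline_integrable :: "real \<Rightarrow> (complex \<Rightarrow> complex) \<Rightarrow> bool" where
  "vline_integrable c0 h \<longleftrightarrow> integrable lborel (\<lambda>t. h (Complex c0 t))"

definition vline_integral :: "real \<Rightarrow> (complex \<Rightarrow> complex) \<Rightarrow> complex" where
  "vline_integral c0 h = \<i> * (LINT t|lborel. h (Complex c0 t))"

definition vline_L1_norm :: "real \<Rightarrow> (complex \<Rightarrow> complex) \<Rightarrow> real" where
  "vline_L1_norm c0 h = (LINT t|lborel. norm (h (Complex c0 t)))"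

definition inverse_mellin :: "real \<Rightarrow> (complex \<Rightarrow> complex) \<Rightarrow> real \<Rightarrow> complex" where
  "inverse_mellin c0 g x =
     1 / (2 * complex_of_real pi * \<i>) *
       vline_integral c0 (\<lambda>s. g s * complex_of_real x powr (- s))"

definition inverse_mellin_rep ::
    "real \<Rightarrow> (real \<Rightarrow> complex) \<Rightarrow> (complex \<Rightarrow> complex) \<Rightarrow> bool" where
  "inverse_mellin_rep c0 f g \<longleftrightarrow>
     vline_integrable c0 g \<and> (\<forall>x>0. f x = inverse_mellin c0 g x)"

text \<open>
  Functions on \<open>(0, \<infinity>)\<close> are represented by functions on the reals whose values at
  arguments \<open>x \<le> 0\<close> are never used.
\<close>

definition inverse_mellin_space :: "real \<Rightarrow> (real \<Rightarrow> complex) set" where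
  "inverse_mellin_space c0 = {f. \<exists>g. inverse_mellin_rep c0 f g}"

text \<open>
  The function \<open>g\<close> representing \<open>f\<close> is determined almost everywhere on the line by \<open>f\<close>
  (injectivity of the Fourier transform on L1), so the norm does not depend on the choice.
\<close>

definition inverse_mellin_norm :: "real \<Rightarrow> (real \<Rightarrow> complex) \<Rightarrow> real" where
  "inverse_mellin_norm c0 f =
     1 / (2 * pi) * vline_L1_norm c0 (SOME g. inverse_mellin_rep c0 f g)"

text \<open>
  The modified Bessel function of the second kind of complex order \<open>z\<close> at a real argument
  \<open>x > 0\<close>, defined by its classical integral (DLMF 10.32.9), which converges absolutely for
  all such \<open>z\<close> and \<open>x\<close>.
\<close>

definition Macdonald_K :: "complex \<Rightarrow> real \<Rightarrow> complex" where
  "Macdonald_K z x =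
     (LINT u:{0<..}|lborel. complex_of_real (exp (- x * cosh u)) * cosh (z * complex_of_real u))"

definition F_integrand :: "(real \<Rightarrow> complex) \<Rightarrow> complex \<Rightarrow> real \<Rightarrow> complex" where
  "F_integrand f z x = complex_of_real x powr (z / 2) * Macdonald_K z (2 * sqrt x) * f x"

definition F_transform :: "(real \<Rightarrow> complex) \<Rightarrow> complex \<Rightarrow> complex" where
  "F_transform f z = 2 * (LINT x:{0<..}|lborel. F_integrand f z x)"

text \<open>
  Boundedness and operator norm of a map from \<open>V\<close> with norm \<open>nV\<close> into a space with norm
  \<open>nW\<close>. The infimum is meaningful only for bounded maps.
\<close>

definition bounded_operator ::
    "'a set \<Rightarrow> ('a \<Rightarrow> real) \<Rightarrow> ('b \<Rightarrow> real) \<Rightarrow> ('a \<Rightarrow> 'b) \<Rightarrow> bool" where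
  "bounded_operator V nV nW T \<longleftrightarrow> (\<exists>C\<ge>0. \<forall>f\<in>V. nW (T f) \<le> C * nV f)"

definition operator_norm ::
    "'a set \<Rightarrow> ('a \<Rightarrow> real) \<Rightarrow> ('b \<Rightarrow> real) \<Rightarrow> ('a \<Rightarrow> 'b) \<Rightarrow> real" where
  "operator_norm V nV nW T = Inf {C. C \<ge> 0 \<and> (\<forall>f\<in>V. nW (T f) \<le> C * nV f)}"

end

theory Submission
  imports Defs "HOL-Probability.Sinc_Integral" "HOL-Real_Asymp.Real_Asymp"
begin

text \<open>
  Everything rests on one Mellin transform: for \<open>Re w > 0\<close> and \<open>Re (w + z) > 0\<close>,
  \<open>2 \<integral> x\<^sup>w\<^sup>-\<^sup>1 x\<^bsup>z/2\<^esup> K\<^sub>z(2 \<surd>x) dx = \<Gamma>(w) \<Gamma>(w + z)\<close>, absolutely convergent over \<open>(0, \<infinity>)\<close>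
  (\<open>Mellin_transform_kernel\<close>). It comes from the representation
  \<open>2 x\<^bsup>z/2\<^esup> K\<^sub>z(2 \<surd>x) = \<integral> t\<^sup>z\<^sup>-\<^sup>1 exp (- t - x / t) dt\<close> (\<open>Macdonald_K_eq_kernel_integral\<close>),
  which is the defining integral of \<open>K\<^sub>z\<close> unfolded to the whole line and read in the variable
  \<open>t = \<surd>x e\<^sup>u\<close>: integrating first over \<open>x\<close> gives \<open>t\<^sup>w \<Gamma>(w)\<close>, and then the integral over \<open>t\<close>
  is Euler's integral for \<open>\<Gamma>(w + z)\<close>.

  Inserting the inverse Mellin integral for \<open>f\<close> into the definition of \<open>F f\<close> and exchanging
  the two integrations then replaces \<open>x\<^sup>-\<^sup>s\<close> by its transform at \<open>w = 1 - s\<close>. This is the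
  Gamma representation of \<open>F f\<close>. Fubini applies because on the line \<open>Re s = c0\<close> the modulus
  of \<open>x\<^sup>-\<^sup>s\<close> depends on \<open>x\<close> only, so the absolute value of the double integrand is a product of
  an integrable function of \<open>x\<close> and one of \<open>s\<close>; the condition \<open>Re z > c0 - 1\<close> is exactly
  \<open>Re (w + z) > 0\<close>.

  The remaining claims are read off from the representation with the help of
  \<open>\<bar>\<Gamma>(z)\<bar> \<le> \<Gamma>(Re z)\<close>. Locally in \<open>z\<close> its integrand is dominated by a constant multiple of
  \<open>\<bar>f\<^sup>*\<bar>\<close>, so differentiation under the integral sign is allowed. On the line \<open>Re z = \<sigma>\<close>
  the representation is, up to the factor \<open>1 / (2 \<pi>)\<close>, the convolution of \<open>\<tau> \<mapsto> \<Gamma>(1 - c0 + \<sigma> + i \<tau>)\<close> with \<open>\<Gamma>(1 - s) f\<^sup>*(s)\<close>, and Young's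
  inequality in \<open>L\<^sub>1\<close> gives the norm estimate; the first factor is integrable because two steps of
  the functional equation show that it decays like \<open>\<tau>\<^sup>-\<^sup>2\<close>. The estimate holds for every
  function \<open>f\<^sup>*\<close> representing \<open>f\<close>, in particular for the one chosen in the norm of \<open>f\<close>.
\<close>

section \<open>Lebesgue integrals over the line and half-lines\<close>

lemma norm_of_real_powr:
  fixes z :: complex
  assumes "x > 0" shows "norm (complex_of_real x powr z) = x powr Re z"
  using assms by (simp add: norm_powr_real_powr)

lemma set_borel_measurable_continuous:
  fixes f :: "'a::topological_space \<Rightarrow> 'b::real_normed_vector"
  assumes "A \<in> sets borel" "continuous_on A f"
  shows "set_borel_measurable borel A f"
  using borel_measurable_continuous_on_indicator[OF assms] unfolding set_borel_measurable_def .

lemma set_integral_scale: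
  fixes f :: "real \<Rightarrow> 'a::{banach,second_countable_topology}"
  assumes "c > (0::real)"
  shows "set_integrable lborel {0<..} (\<lambda>x. f (c * x)) \<longleftrightarrow> set_integrable lborel {0<..} f"
    and "(LINT x:{0<..}|lborel. f x) = c *\<^sub>R (LINT x:{0<..}|lborel. f (c * x))"
proof -
  have [simp]: "indicat_real {0<..} (c * x) = indicator {0<..} x" for x
    using assms by (auto simp: indicator_def zero_less_mult_iff)
  show "set_integrable lborel {0<..} (\<lambda>x. f (c * x)) \<longleftrightarrow> set_integrable lborel {0<..} f"
    using lborel_integrable_real_affine_iff[of c "\<lambda>x. indicator {0<..} x *\<^sub>R f x" 0] assms
    unfolding set_integrable_def by simp
  show "(LINT x:{0<..}|lborel. f x) = c *\<^sub>R (LINT x:{0<..}|lborel. f (c * x))"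
    using lborel_integral_real_affine[of c "\<lambda>x. indicator {0<..} x *\<^sub>R f x" 0] assms
    unfolding set_lebesgue_integral_def by simp
qed

text \<open>
  The hyperbolic cosine in the defining integral of the Macdonald function is such a folded sum
  of exponentials; read from right to left, the equation unfolds it to the whole line.
\<close>

lemma integral_fold_half_line:
  fixes \<phi> :: "real \<Rightarrow> 'a::{banach,second_countable_topology}"
  assumes "integrable lborel \<phi>"
  shows "(LINT u|lborel. \<phi> u) = (LINT u:{0<..}|lborel. \<phi> u + \<phi> (- u))"
proof -
  have r: "integrable lborel (\<lambda>u. \<phi> (- u))"
    using lborel_integrable_real_affine[OF assms, of "-1" 0] by simp
  have i1: "integrable lborel (\<lambda>u. indicat_real {0<..} u *\<^sub>R \<phi> u)" 
    and i2: "integrable lborel (\<lambda>u. indicat_real {0<..} u *\<^sub>R \<phi> (-u))"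
    and i3: "integrable lborel (\<lambda>u. indicat_real {..<0} u *\<^sub>R \<phi> u)"
    using assms r by (auto intro!: integrable_mult_indicator)
  have "(LINT u|lborel. \<phi> u) = (LINT u|lborel. indicat_real {0<..} u *\<^sub>R \<phi> u + indicat_real {..<0} u *\<^sub>R \<phi> u)"
  proof (rule integral_cong_AE)
    show "AE u in lborel. \<phi> u = indicat_real {0<..} u *\<^sub>R \<phi> u + indicat_real {..<0} u *\<^sub>R \<phi> u"
      using AE_lborel_singleton[of "0::real"] by eventually_elim (auto simp: indicator_def)
  qed (use assms i1 i3 in auto)
  also have "\<dots> = (LINT u|lborel. indicat_real {0<..} u *\<^sub>R \<phi> u) + (LINT u|lborel. indicat_real {..<0} u *\<^sub>R \<phi> u)"
    by (rule Bochner_Integration.integral_add[OF i1 i3])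
  also have "(LINT u|lborel. indicat_real {..<0} u *\<^sub>R \<phi> u) = (LINT u|lborel. indicat_real {0<..} u *\<^sub>R \<phi> (- u))"
    by (subst lborel_integral_real_affine[of "-1" _ 0]) (auto simp: indicator_def intro!: Bochner_Integration.integral_cong)
  also have "(LINT u|lborel. indicat_real {0<..} u *\<^sub>R \<phi> u) + \<dots> = (LINT u:{0<..}|lborel. \<phi> u + \<phi> (- u))"
    unfolding set_lebesgue_integral_def scaleR_add_right by (rule Bochner_Integration.integral_add[OF i1 i2, symmetric])
  finally show ?thesis .
qed

text \<open>
  Continuity serves only to supply the joint measurability that Fubini's theorem asks for.
\<close>

lemma set_Fubini_continuous:
  fixes f :: "real \<Rightarrow> real \<Rightarrow> complex"
  assumes A[measurable]: "A \<in> sets borel" and B[measurable]: "B \<in> sets borel"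
    and cont: "continuous_on (A \<times> B) (\<lambda>(t, x). f t x)"
    and inner: "\<And>t. t \<in> A \<Longrightarrow> set_integrable lborel B (f t)"
    and outer: "set_integrable lborel A (\<lambda>t. LINT x:B|lborel. norm (f t x))"
  shows "set_integrable lborel B (\<lambda>x. LINT t:A|lborel. f t x)"
    and "(LINT x:B|lborel. LINT t:A|lborel. f t x) = (LINT t:A|lborel. LINT x:B|lborel. f t x)"
proof -
  let ?h = "\<lambda>t x. indicat_real A t *\<^sub>R (indicat_real B x *\<^sub>R f t x)"
  have eq: "indicat_real (A \<times> B) p *\<^sub>R (\<lambda>(t, x). f t x) p = (\<lambda>(t, x). ?h t x) p" for p
    by (cases p) (auto simp: indicator_def)
  have "A \<times> B \<in> sets borel"
    unfolding borel_prod[symmetric] by measurable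
  from borel_measurable_continuous_on_indicator[OF this cont]
  have "(\<lambda>(t, x). ?h t x) \<in> borel_measurable (lborel \<Otimes>\<^sub>M lborel)"
    unfolding eq lborel_prod by simp
  have int: "integrable (lborel \<Otimes>\<^sub>M lborel) (\<lambda>(t, x). ?h t x)"
  proof (rule lborel_pair.Fubini_integrable)
    show "integrable lborel (\<lambda>t. LINT x|lborel. norm (case (t, x) of (t, x) \<Rightarrow> ?h t x))"
      using outer unfolding set_integrable_def set_lebesgue_integral_def by (simp add: mult.assoc)
    have "integrable lborel (?h t)" for t
      using inner[of t] by (cases "t \<in> A") (auto simp: set_integrable_def)
    then show "AE t in lborel. integrable lborel (\<lambda>x. case (t, x) of (t, x) \<Rightarrow> ?h t x)" by simp
  qed fact
  have in1: "(LINT t|lborel. ?h t x) = indicat_real B x *\<^sub>R (LINT t:A|lborel. f t x)" for x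
    unfolding set_lebesgue_integral_def by (cases "x \<in> B") simp_all
  have in2: "(LINT x|lborel. ?h t x) = indicat_real A t *\<^sub>R (LINT x:B|lborel. f t x)" for t
    unfolding set_lebesgue_integral_def by (cases "t \<in> A") simp_all
  show "set_integrable lborel B (\<lambda>x. LINT t:A|lborel. f t x)"
    using lborel_pair.integrable_snd[OF int] unfolding in1 set_integrable_def .
  show "(LINT x:B|lborel. LINT t:A|lborel. f t x) = (LINT t:A|lborel. LINT x:B|lborel. f t x)"
    using lborel_pair.Fubini_integral[OF int] unfolding in1 in2 
    by (simp add: set_lebesgue_integral_def)
qed

section \<open>Differentiation under the integral sign\<close>

text \<open>
  By Cauchy's inequality a local integrable bound on \<open>h\<close> itself also bounds its derivative in
  \<open>z\<close>, hence by the mean value inequality its difference quotients, and dominated convergence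
  applies to these. The parameter \<open>t\<close> runs over an arbitrary measure space, since the function
  \<open>f\<^sup>*\<close> in the later application is only integrable.
\<close>

lemma holomorphic_on_integral_param:
  fixes h :: "complex \<Rightarrow> 'a \<Rightarrow> complex"
  assumes "open S"
    and hol: "\<And>t. t \<in> space M \<Longrightarrow> (\<lambda>z. h z t) holomorphic_on S"
    and int: "\<And>z. z \<in> S \<Longrightarrow> integrable M (h z)"
    and dom: "\<And>z. z \<in> S \<Longrightarrow> \<exists>r>0. \<exists>B. integrable M B \<and> (\<forall>w\<in>ball z r \<inter> S. \<forall>t\<in>space M. norm (h w t) \<le> B t)"
  shows "(\<lambda>z. LINT t|M. h z t) holomorphic_on S"
proof -
  let ?G = "\<lambda>z. LINT t|M. h z t"
  have "\<exists>D. (?G has_field_derivative D) (at z)" if "z \<in> S" for z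
  proof -
    obtain r0 B where r0: "r0 > 0" "integrable M B" "\<And>w t. w \<in> ball z r0 \<inter> S \<Longrightarrow> t \<in> space M \<Longrightarrow> norm (h w t) \<le> B t"
      using dom[OF \<open>z \<in> S\<close>] by blast
    obtain r1 where r1: "r1 > 0" "ball z r1 \<subseteq> S"
      using \<open>open S\<close> \<open>z \<in> S\<close> openE by blast
    \<comment> \<open>Half the available radius: discs of radius \<open>r\<close> about points of the disc \<open>ball z r\<close>
      then stay inside the region where the bound holds.\<close>
    define r where "r = min r0 r1 / 2"
    have r: "r > 0" using r0 r1 by (simp add: r_def)
    have sub: "cball w r \<subseteq> ball z r0 \<inter> S" if "w \<in> ball z r" for w
    proof
      fix y assume "y \<in> cball w r"
      then have "dist z y < 2 * r" using that dist_triangle[of z y w] by simp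
      then show "y \<in> ball z r0 \<inter> S" using r1 by (auto simp: r_def)
    qed
    have derh: "norm (deriv (\<lambda>z. h z t) w) \<le> B t / r" if "w \<in> ball z r" "t \<in> space M" for w t
    proof -
      have "norm ((deriv ^^ 1) (\<lambda>z. h z t) w) \<le> fact 1 * B t / r ^ 1"
      proof (rule Cauchy_inequality[OF _ _ r])
        show "(\<lambda>z. h z t) holomorphic_on ball w r"
          using hol[OF that(2)] sub[OF that(1)] ball_subset_cball holomorphic_on_subset by blast
        show "continuous_on (cball w r) (\<lambda>z. h z t)"
          using hol[OF that(2)] sub[OF that(1)] by (meson Int_lower2 continuous_on_subset holomorphic_on_imp_continuous_on subset_trans)
        show "norm (h x t) \<le> B t" if "norm (w - x) = r" for x
          using that sub[OF \<open>w \<in> ball z r\<close>] by (intro r0(3) \<open>t \<in> space M\<close>) (auto simp: subset_eq dist_norm)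
      qed
      then show ?thesis by simp
    qed
    have dh: "((\<lambda>z. h z t) has_field_derivative deriv (\<lambda>z. h z t) w) (at w)" if "w \<in> S" "t \<in> space M" for w t
      using hol[OF that(2)] \<open>open S\<close> that(1) by (rule holomorphic_derivI)
    have lip: "norm ((h w t - h z t) / (w - z)) \<le> B t / r" if "w \<in> ball z r" "w \<noteq> z" "t \<in> space M" for w t
    proof -
      have "norm (h w t - h z t) \<le> B t / r * norm (w - z)"
      proof (rule field_differentiable_bound[of "ball z r"])
        fix v assume v: "v \<in> ball z r"
        then have "v \<in> S" using sub[OF v] r by auto
        then show "((\<lambda>z. h z t) has_field_derivative deriv (\<lambda>z. h z t) v) (at v within ball z r)"
          using dh that by (blast intro: has_field_derivative_at_within)
      qed (use derh that r in auto)
      then show ?thesis using that by (simp add: norm_divide field_simps)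
    qed
    have "(?G has_field_derivative (LINT t|M. deriv (\<lambda>z. h z t) z)) (at z)"
      unfolding has_field_derivative_iff tendsto_at_iff_sequentially
    proof (intro allI impI)
      fix X :: "nat \<Rightarrow> complex"
      assume X: "\<forall>i. X i \<in> UNIV - {z}" "X \<longlonglongrightarrow> z"
      have "eventually (\<lambda>i. X i \<in> ball z r) sequentially"
        using X(2) r by (intro topological_tendstoD) auto
      then obtain N where N: "\<And>i. i \<ge> N \<Longrightarrow> X i \<in> ball z r" by (auto simp: eventually_sequentially)
      \<comment> \<open>Dominated convergence needs the bound for every index, so an initial segment is dropped.\<close>
      define Y where "Y i = X (i + N)" for i
      have Y: "Y i \<in> ball z r" "Y i \<noteq> z" "Y i \<in> S" for i
        using N[of "i + N"] X(1) sub[of "Y i"] r by (auto simp: Y_def)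
      have lim: "(\<lambda>i. (h (Y i) t - h z t) / (Y i - z)) \<longlonglongrightarrow> deriv (\<lambda>z. h z t) z" if "t \<in> space M" for t
      proof -
        have "Y \<longlonglongrightarrow> z" using X(2) unfolding Y_def by (rule LIMSEQ_ignore_initial_segment)
        then show ?thesis
          using dh[OF \<open>z \<in> S\<close> that] Y(2) unfolding has_field_derivative_iff tendsto_at_iff_sequentially
          by (auto simp: o_def)
      qed
      have [measurable]: "h w \<in> borel_measurable M" if "w \<in> S" for w
        using int[OF that] by simp
      have m: "(\<lambda>t. (h (Y i) t - h z t) / (Y i - z)) \<in> borel_measurable M" for i
        using Y(3)[of i] \<open>z \<in> S\<close> by simp
      have "(\<lambda>i. LINT t|M. (h (Y i) t - h z t) / (Y i - z)) \<longlonglongrightarrow> (LINT t|M. deriv (\<lambda>z. h z t) z)"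
      proof (rule integral_dominated_convergence)
        show "(\<lambda>t. deriv (\<lambda>z. h z t) z) \<in> borel_measurable M"
          by (rule borel_measurable_LIMSEQ_metric[OF m lim])
        show "integrable M (\<lambda>t. B t / r)" using r0 by simp
      qed (use m lim lip Y in auto)
      moreover have "(LINT t|M. (h (Y i) t - h z t) / (Y i - z)) = (?G (Y i) - ?G z) / (Y i - z)" for i
        using int[OF Y(3)[of i]] int[OF \<open>z \<in> S\<close>] by simp
      ultimately have "(\<lambda>i. (?G (X (i + N)) - ?G z) / (X (i + N) - z)) \<longlonglongrightarrow> (LINT t|M. deriv (\<lambda>z. h z t) z)"
        by (simp only: Y_def)
      then show "((\<lambda>y. (?G y - ?G z) / (y - z)) \<circ> X) \<longlonglongrightarrow> (LINT t|M. deriv (\<lambda>z. h z t) z)"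
        unfolding o_def by (rule LIMSEQ_offset)
    qed
    then show ?thesis by blast
  qed
  then show ?thesis
    using \<open>open S\<close> by (simp add: holomorphic_on_open)
qed

section \<open>The Gamma function in the right half-plane\<close>

text \<open>
  Euler's integral as a Lebesgue integral, the form in which it can enter Fubini's theorem.
\<close>

lemma Gamma_set_integral:
  assumes "Re z > 0"
  shows "set_integrable lborel {0<..} (\<lambda>t. complex_of_real t powr (z - 1) * exp (- complex_of_real t))"
    and "(LINT t:{0<..}|lborel. complex_of_real t powr (z - 1) * exp (- complex_of_real t)) = Gamma z"
proof -
  let ?f = "\<lambda>t. complex_of_real t powr (z - 1) * exp (- complex_of_real t)"
  have eq: "?f = (\<lambda>t. complex_of_real t powr (z - 1) / of_real (exp t))"
    by (simp add: fun_eq_iff exp_minus divide_inverse exp_of_real)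
  have "continuous_on {0<..} ?f"
    by (auto intro!: continuous_intros)
  then have "set_borel_measurable borel {0<..} ?f"
    by (intro set_borel_measurable_continuous) auto
  moreover have "?f absolutely_integrable_on {0<..}"
    unfolding eq by (rule absolutely_integrable_Gamma_integral'[OF assms])
  ultimately show *: "set_integrable lborel {0<..} ?f"
    unfolding set_integrable_def set_borel_measurable_def
    by (subst (asm) integrable_completion) simp_all
  show "(LINT t:{0<..}|lborel. ?f t) = Gamma z"
    using set_borel_integral_eq_integral(2)[OF *] Gamma_integral_complex'[OF assms]
    unfolding eq by (simp add: integral_unique)
qed

lemma Gamma_set_integral_real:
  assumes "a > (0::real)"
  shows "(LINT t:{0<..}|lborel. t powr (a - 1) * exp (- t)) = Gamma a"
proof -
  have "complex_of_real (LINT t:{0<..}|lborel. t powr (a - 1) * exp (- t))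
     = (LINT t:{0<..}|lborel. complex_of_real (t powr (a - 1) * exp (- t)))"
    unfolding set_lebesgue_integral_def by (simp flip: integral_complex_of_real add: scaleR_conv_of_real)
  also have "\<dots> = (LINT t:{0<..}|lborel. complex_of_real t powr (complex_of_real a - 1) * exp (- complex_of_real t))"
    by (intro set_lebesgue_integral_cong) (auto simp: powr_of_real[symmetric] simp flip: exp_of_real)
  also have "\<dots> = complex_of_real (Gamma a)"
    using Gamma_set_integral(2)[of a] assms by (simp add: Gamma_complex_of_real)
  finally show ?thesis using of_real_eq_iff by blast
qed

lemma set_integral_norm_Gamma_kernel:
  assumes "Re z > 0"
  shows "(LINT t:{0<..}|lborel. norm (complex_of_real t powr (z - 1) * exp (- complex_of_real t)))
    = Gamma (Re z)"
  unfolding Gamma_set_integral_real[OF assms, symmetric]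
  by (intro set_lebesgue_integral_cong) (auto simp: norm_mult norm_of_real_powr)

text \<open>
  Taking absolute values inside Euler's integral replaces \<open>z\<close> by its real part.
\<close>

lemma norm_Gamma_le:
  assumes "Re z > 0" shows "norm (Gamma z) \<le> Gamma (Re z)"
  using set_integral_norm_bound[OF Gamma_set_integral(1)[OF assms]]
  by (simp only: Gamma_set_integral(2)[OF assms] set_integral_norm_Gamma_kernel[OF assms])

lemma scaled_Gamma_set_integral:
  assumes "Re w > 0" "t > 0"
  shows "set_integrable lborel {0<..} (\<lambda>x. complex_of_real x powr (w - 1) * exp (- complex_of_real (x / t)))"
    and "(LINT x:{0<..}|lborel. complex_of_real x powr (w - 1) * exp (- complex_of_real (x / t)))
      = complex_of_real t powr w * Gamma w"
    and "(LINT x:{0<..}|lborel. norm (complex_of_real x powr (w - 1) * exp (- complex_of_real (x / t))))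
      = t powr Re w * Gamma (Re w)"
proof -
  let ?f = "\<lambda>x. complex_of_real x powr (w - 1) * exp (- complex_of_real (x / t))"
  let ?g = "\<lambda>x. complex_of_real x powr (w - 1) * exp (- complex_of_real x)"
  have f: "?f (t * x) = complex_of_real t powr (w - 1) * ?g x" if "x \<in> {0<..}" for x
    using that assms by (simp add: powr_times_real)
  have n: "norm (?f (t * x)) = t powr (Re w - 1) * norm (?g x)" if "x \<in> {0<..}" for x
    unfolding f[OF that] using assms by (simp add: norm_mult norm_of_real_powr)
  show "set_integrable lborel {0<..} ?f"
    using Gamma_set_integral(1)[OF assms(1)] assms
    by (subst set_integral_scale(1)[OF assms(2), symmetric])
       (subst set_integrable_cong[OF refl refl f], auto)
  have "(LINT x:{0<..}|lborel. ?f x) = t *\<^sub>R (LINT x:{0<..}|lborel. ?f (t * x))"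
    by (rule set_integral_scale(2)[OF assms(2)])
  also have "(LINT x:{0<..}|lborel. ?f (t * x)) = (LINT x:{0<..}|lborel. complex_of_real t powr (w - 1) * ?g x)"
    by (rule set_lebesgue_integral_cong) (use f in auto)
  also have "t *\<^sub>R \<dots> = complex_of_real t powr w * Gamma w"
    using assms unfolding set_integral_mult_right Gamma_set_integral(2)[OF assms(1)]
    by (simp add: scaleR_conv_of_real powr_diff)
  finally show "(LINT x:{0<..}|lborel. ?f x) = complex_of_real t powr w * Gamma w" .
  have "(LINT x:{0<..}|lborel. norm (?f x)) = t *\<^sub>R (LINT x:{0<..}|lborel. norm (?f (t * x)))"
    by (rule set_integral_scale(2)[OF assms(2)])
  also have "(LINT x:{0<..}|lborel. norm (?f (t * x))) = (LINT x:{0<..}|lborel. t powr (Re w - 1) * norm (?g x))"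
    by (rule set_lebesgue_integral_cong) (use n in auto)
  also have "t *\<^sub>R \<dots> = t powr Re w * Gamma (Re w)"
    using assms unfolding set_integral_mult_right set_integral_norm_Gamma_kernel[OF assms(1)]
    by (simp add: powr_diff)
  finally show "(LINT x:{0<..}|lborel. norm (?f x)) = t powr Re w * Gamma (Re w)" .
qed

lemma Gamma_vertical_continuous:
  assumes "a > 0" shows "continuous_on UNIV (\<lambda>\<tau>. Gamma (Complex a \<tau>))"
proof -
  have "continuous_on {z. Re z > 0} (Gamma :: complex \<Rightarrow> complex)"
    by (rule continuous_on_Gamma) (auto elim!: nonpos_Ints_cases)
  moreover have "continuous_on UNIV (Complex a)"
    unfolding Complex_eq by (intro continuous_intros)
  ultimately show ?thesis
    by (rule continuous_on_compose2) (use assms in auto)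
qed

text \<open>
  Since \<open>\<Gamma>(z) = \<Gamma>(z + 2) / (z (z + 1))\<close> and the numerator is bounded on the line \<open>Re z = a\<close>,
  the modulus is at most a constant times \<open>1 / (a\<^sup>2 + \<tau>\<^sup>2)\<close>. Two steps are the least that give
  integrability at infinity by this argument.
\<close>

lemma Gamma_vertical_integrable:
  assumes "a > (0::real)"
  shows "integrable lborel (\<lambda>\<tau>. Gamma (Complex a \<tau>))"
proof -
  have ne: "Complex a \<tau> \<notin> \<int>\<^sub>\<le>\<^sub>0" for \<tau> using assms by (auto elim!: nonpos_Ints_cases simp: complex_eq_iff)
  have bound: "norm (Gamma (Complex a \<tau>)) \<le> Gamma (a + 2) * (max 1 (1 / a\<^sup>2) * inverse (1 + \<tau>\<^sup>2))" for \<tau>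
  proof -
    let ?z = "Complex a \<tau>"
    have "Gamma (?z + 1 + 1) = (?z + 1) * (?z * Gamma ?z)"
      using ne[of \<tau>] plus_one_in_nonpos_Ints_imp[of ?z] by (metis Gamma_plus1)
    moreover have "?z + 1 + 1 = ?z + 2" by simp
    ultimately have "Gamma (?z + 2) = (?z + 1) * (?z * Gamma ?z)" by metis
    then have "norm (?z + 1) * norm ?z * norm (Gamma ?z) \<le> Gamma (a + 2)"
      using norm_Gamma_le[of "?z + 2"] assms by (simp add: norm_mult mult.assoc)
    moreover have "norm ?z * norm ?z \<le> norm (?z + 1) * norm ?z"
      using assms by (intro mult_right_mono) (auto simp: cmod_def power2_eq_square algebra_simps)
    moreover have "norm ?z * norm ?z = a\<^sup>2 + \<tau>\<^sup>2"
      by (simp add: cmod_def)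
    ultimately have "(a\<^sup>2 + \<tau>\<^sup>2) * norm (Gamma ?z) \<le> Gamma (a + 2)"
      by (smt (verit) mult_right_mono norm_ge_zero)
    moreover have pos: "0 < a\<^sup>2 + \<tau>\<^sup>2" using assms by (simp add: add_pos_nonneg)
    ultimately have 1: "norm (Gamma ?z) \<le> Gamma (a + 2) * inverse (a\<^sup>2 + \<tau>\<^sup>2)"
      by (metis divide_inverse mult.commute pos_le_divide_eq)
    \<comment> \<open>Comparison of \<open>1 / (a\<^sup>2 + \<tau>\<^sup>2)\<close> with \<open>1 / (1 + \<tau>\<^sup>2)\<close>, whose integrability is known.\<close>
    have "1 + \<tau>\<^sup>2 \<le> max 1 (1 / a\<^sup>2) * (a\<^sup>2 + \<tau>\<^sup>2)"
    proof -
      have "1 \<le> max 1 (1 / a\<^sup>2) * a\<^sup>2"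
        using assms by (auto simp: max_def field_simps)
      moreover have "1 * \<tau>\<^sup>2 \<le> max 1 (1 / a\<^sup>2) * \<tau>\<^sup>2" by (intro mult_right_mono) auto
      ultimately show ?thesis by (simp add: distrib_left)
    qed
    then have "(1 + \<tau>\<^sup>2) * inverse (a\<^sup>2 + \<tau>\<^sup>2) \<le> max 1 (1 / a\<^sup>2)"
      using pos by (simp only: divide_inverse[symmetric] pos_divide_le_eq)
    then have "(1 + \<tau>\<^sup>2) * inverse (a\<^sup>2 + \<tau>\<^sup>2) * inverse (1 + \<tau>\<^sup>2) \<le> max 1 (1 / a\<^sup>2) * inverse (1 + \<tau>\<^sup>2)"
      by (rule mult_right_mono) simp
    moreover have "(1 + \<tau>\<^sup>2) * inverse (a\<^sup>2 + \<tau>\<^sup>2) * inverse (1 + \<tau>\<^sup>2) = inverse (a\<^sup>2 + \<tau>\<^sup>2)"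
      using add_pos_nonneg[of 1 "\<tau>\<^sup>2"] by simp
    ultimately have "inverse (a\<^sup>2 + \<tau>\<^sup>2) \<le> max 1 (1 / a\<^sup>2) * inverse (1 + \<tau>\<^sup>2)"
      by simp
    then show ?thesis
      using 1 Gamma_real_pos[of "a + 2"] assms by (meson add_pos_pos less_imp_le mult_left_mono order_trans zero_less_numeral)
  qed
  have "integrable lborel (\<lambda>\<tau>. Gamma (a + 2) * (max 1 (1 / a\<^sup>2) * inverse (1 + \<tau>\<^sup>2)))"
    using integrable_inverse_1_plus_square by (simp add: set_integrable_def)
  moreover have "(\<lambda>\<tau>. Gamma (Complex a \<tau>)) \<in> borel_measurable lborel"
    using borel_measurable_continuous_onI[OF Gamma_vertical_continuous[OF assms]] by simp
  ultimately show ?thesis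
    by (rule Bochner_Integration.integrable_bound)
       (use bound in \<open>auto intro: order_trans[OF _ abs_ge_self]\<close>)
qed

section \<open>The Macdonald function and its Mellin transform\<close>

text \<open>
  At small \<open>t\<close> the factor \<open>exp (- x / t)\<close> has to beat any power of \<open>t\<close>; this is the estimate
  for it, with \<open>y = x / t\<close>. It is the \<open>n\<close>-th power of \<open>y / n \<le> exp (y / n)\<close>.
\<close>

lemma exp_minus_le_power:
  assumes "y > (0::real)" "n > 0" shows "exp (- y) \<le> (real n / y) ^ n"
proof -
  have "y / n \<le> exp (y / n)" using exp_ge_add_one_self[of "y/n"] by linarith
  then have "(y / n) ^ n \<le> exp (y / n) ^ n" using assms by (intro power_mono) auto
  also have "\<dots> = exp y" using assms by (simp flip: exp_of_nat_mult)
  finally show ?thesis using assms by (simp add: exp_minus power_divide field_simps)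
qed

text \<open>
  The factor \<open>exp (- x / t)\<close> is bounded by a multiple of \<open>t\<^sup>n\<close>, and for \<open>n > - Re z\<close> the
  resulting majorant is the integrand of Euler's integral for \<open>\<Gamma>(z + n)\<close>.
\<close>

lemma kernel_set_integrable:
  assumes "x > 0"
  shows "set_integrable lborel {0<..} (\<lambda>t. complex_of_real t powr (z - 1) * exp (- complex_of_real (t + x / t)))"
proof -
  obtain n :: nat where n: "real n > max 0 (- Re z)" using reals_Archimedean2 by blast
  let ?g = "\<lambda>t. complex_of_real t powr (z + n - 1) * exp (- complex_of_real t)"
  have "set_integrable lborel {0<..} ?g"
    using n by (intro Gamma_set_integral) auto
  then have g: "set_integrable lborel {0<..} (\<lambda>t. complex_of_real ((n / x) ^ n) * ?g t)"
    by simp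
  show ?thesis
  proof (rule set_integrable_bound[OF g])
    show "set_borel_measurable lborel {0<..} (\<lambda>t. complex_of_real t powr (z - 1) * exp (- complex_of_real (t + x / t)))"
      using set_borel_measurable_continuous[of "{0::real<..}" "\<lambda>t. complex_of_real t powr (z - 1) * exp (- complex_of_real (t + x / t))"]
      unfolding set_borel_measurable_def by (auto intro!: continuous_intros)
    have "norm (complex_of_real t powr (z - 1) * exp (- complex_of_real (t + x / t)))
      \<le> norm (complex_of_real ((n / x) ^ n) * ?g t)" if "t > 0" for t
    proof -
      have "exp (- (x / t)) \<le> (n / x) ^ n * t ^ n"
        using exp_minus_le_power[of "x/t" n] that assms n by (simp add: field_simps)
      then have "t powr (Re z - 1) * exp (- t) * exp (- (x / t)) \<le> t powr (Re z - 1) * exp (- t) * ((n / x) ^ n * t ^ n)"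
        by (intro mult_left_mono) auto
      also have "\<dots> = (n / x) ^ n * (t powr (Re z + n - 1) * exp (- t))"
        using that by (simp add: powr_add powr_diff powr_realpow)
      finally have "t powr (Re z - 1) * exp (- (t + x / t)) \<le> (n / x) ^ n * (t powr (Re z + n - 1) * exp (- t))"
        by (simp add: exp_add mult.assoc flip: exp_add)
      then show ?thesis
        using that assms n by (simp add: norm_mult norm_of_real_powr norm_power norm_divide)
    qed
    then show "AE t in lborel. t \<in> {0<..} \<longrightarrow> norm (complex_of_real t powr (z - 1) * exp (- complex_of_real (t + x / t)))
      \<le> norm (complex_of_real ((n / x) ^ n) * ?g t)" by auto
  qed
qed

text \<open>
  With \<open>u = ln t - ln x / 2\<close> one has \<open>2 \<surd>x cosh u = t + x / t\<close> and
  \<open>exp (z u) du = x\<^bsup>-z/2\<^esup> t\<^sup>z\<^sup>-\<^sup>1 dt\<close>, so the substitution turns the integral of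
  \<open>exp (z u - 2 \<surd>x cosh u)\<close> over the whole line into the right-hand side.
\<close>

lemma Macdonald_K_eq_kernel_integral:
  assumes "x > 0"
  shows "2 * (complex_of_real x powr (z / 2) * Macdonald_K z (2 * sqrt x)) =
    (LINT t:{0<..}|lborel. complex_of_real t powr (z - 1) * exp (- complex_of_real (t + x / t)))"
proof -
  define g where "g t = ln t - ln x / 2" for t :: real
  define \<phi> where "\<phi> u = exp (z * complex_of_real u) * complex_of_real (exp (- (2 * sqrt x) * cosh u))" for u :: real
  let ?k = "\<lambda>t. complex_of_real t powr (z - 1) * exp (- complex_of_real (t + x / t))"
  have cosh_g: "2 * sqrt x * cosh (g t) = t + x / t" if "t > 0" for t
  proof -
    have "exp (ln x / 2) = sqrt x" using assms by (simp flip: ln_sqrt)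
    then have "exp (g t) = t / sqrt x" "exp (- g t) = sqrt x / t"
      using that assms by (simp_all add: g_def exp_diff)
    then show ?thesis
      using that assms by (simp add: cosh_field_def distrib_left real_div_sqrt)
  qed
  have \<phi>_g: "(1 / t) *\<^sub>R \<phi> (g t) = complex_of_real x powr (- z / 2) * ?k t" if "t > 0" for t
  proof -
    have "exp (z * complex_of_real (g t)) = complex_of_real t powr z * complex_of_real x powr (- z / 2)"
      using that assms by (simp add: g_def powr_def Ln_of_real' algebra_simps flip: exp_add)
    moreover have "complex_of_real (exp (- (2 * sqrt x) * cosh (g t))) = exp (- complex_of_real (t + x / t))"
      using cosh_g[OF that] by (simp flip: exp_of_real)
    ultimately show ?thesis
      unfolding \<phi>_def using that by (simp add: powr_diff scaleR_conv_of_real)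
  qed
  have kint: "set_integrable lborel (einterval 0 \<infinity>) (\<lambda>t. (1 / t) *\<^sub>R \<phi> (g t))"
  proof -
    have "set_integrable lborel {0<..} (\<lambda>t. complex_of_real x powr (- z / 2) * ?k t)"
      using kernel_set_integrable[OF assms, of z] by simp
    then show ?thesis
      by (subst (asm) set_integrable_cong[OF refl refl \<phi>_g[symmetric]]) (auto simp: einterval_def greaterThan_def)
  qed
  have cont: "isCont \<phi> u" for u unfolding \<phi>_def by (auto intro!: continuous_intros)
  have deriv: "DERIV g t :> 1 / t" if "ereal 0 < ereal t" for t
    unfolding g_def using that by (auto intro!: derivative_eq_intros)
  have lim0: "((ereal \<circ> g \<circ> real_of_ereal) \<longlongrightarrow> -\<infinity>) (at_right 0)"
    unfolding zero_ereal_def ereal_tendsto_simps g_def 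
    by real_asymp
  have limi: "((ereal \<circ> g \<circ> real_of_ereal) \<longlongrightarrow> \<infinity>) (at_left \<infinity>)"
    unfolding ereal_tendsto_simps g_def 
    by real_asymp
  \<comment> \<open>Integrability over the whole line is obtained from that of the kernel in \<open>t\<close>, by the
    substitution rule for nonnegative functions.\<close>
  have norm_\<phi>: "set_integrable lborel (einterval (-\<infinity>) \<infinity>) (\<lambda>u. norm (\<phi> u))"
  proof (rule interval_integral_substitution_nonneg(1)[OF _ _ _ _ _ _ lim0 limi])
    show "set_integrable lborel (einterval 0 \<infinity>) (\<lambda>t. norm (\<phi> (g t)) * (1 / t))"
      using set_integrable_norm[OF kint]
      by (subst (asm) set_integrable_cong[OF refl refl]) (auto simp: einterval_def)
  qed (use cont deriv in \<open>auto intro!: continuous_intros\<close>)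
  have [measurable]: "\<phi> \<in> borel_measurable borel"
    using cont by (intro borel_measurable_continuous_onI) (simp add: continuous_at_imp_continuous_on)
  have int\<phi>: "integrable lborel \<phi>"
    using norm_\<phi> by (auto simp: set_integrable_def intro: integrable_norm_cancel)
  have "2 * Macdonald_K z (2 * sqrt x) = (LINT u:{0<..}|lborel. \<phi> u + \<phi> (- u))"
    unfolding Macdonald_K_def set_integral_mult_right[symmetric]
    by (intro set_lebesgue_integral_cong)
       (auto simp: \<phi>_def cosh_field_def algebra_simps)
  also have "\<dots> = (LINT u|lborel. \<phi> u)"
    by (rule integral_fold_half_line[OF int\<phi>, symmetric])
  also have "\<dots> = (LBINT u=-\<infinity>..\<infinity>. \<phi> u)"
    by (simp add: interval_lebesgue_integral_def set_lebesgue_integral_def)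
  also have "\<dots> = (LBINT t=0..\<infinity>. (1 / t) *\<^sub>R \<phi> (g t))"
    by (rule interval_integral_substitution_integrable[OF _ _ _ _ _ lim0 limi kint])
       (use cont deriv int\<phi> in \<open>auto simp: set_integrable_def intro!: continuous_intros\<close>)
  also have "\<dots> = (LINT t:{0<..}|lborel. complex_of_real x powr (- z / 2) * ?k t)"
  proof -
    have "einterval 0 \<infinity> = {0::real<..}" by (auto simp: einterval_def)
    then have "(LBINT t=0..\<infinity>. (1 / t) *\<^sub>R \<phi> (g t)) = (LINT t:{0<..}|lborel. (1 / t) *\<^sub>R \<phi> (g t))"
      by (simp add: interval_lebesgue_integral_def)
    also have "\<dots> = (LINT t:{0<..}|lborel. complex_of_real x powr (- z / 2) * ?k t)"
      by (rule set_lebesgue_integral_cong) (use \<phi>_g in auto)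
    finally show ?thesis .
  qed
  also have "\<dots> = complex_of_real x powr (- z / 2) * (LINT t:{0<..}|lborel. ?k t)"
    by (rule set_integral_mult_right)
  finally show ?thesis
    using assms by (simp add: powr_minus field_simps)
qed

text \<open>
  The integral representation of the kernel makes this a double integral of
  \<open>t\<^sup>z\<^sup>-\<^sup>1 exp (- t) x\<^sup>w\<^sup>-\<^sup>1 exp (- x / t)\<close>. Integrated first over \<open>x\<close>, it becomes
  \<open>\<Gamma>(w)\<close> times the Euler integrand of \<open>\<Gamma>(w + z)\<close>; the same computation for the absolute
  values justifies the exchange.
\<close>

lemma Mellin_transform_kernel:
  assumes "Re w > 0" "Re (w + z) > 0"
  shows "set_integrable lborel {0<..}
      (\<lambda>x. complex_of_real x powr (w - 1) * (complex_of_real x powr (z / 2) * Macdonald_K z (2 * sqrt x)))"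
    and "2 * (LINT x:{0<..}|lborel. complex_of_real x powr (w - 1) * 
        (complex_of_real x powr (z / 2) * Macdonald_K z (2 * sqrt x))) = Gamma w * Gamma (w + z)"
proof -
  let ?f = "\<lambda>t x. (complex_of_real t powr (z - 1) * exp (- complex_of_real t)) *
     (complex_of_real x powr (w - 1) * exp (- complex_of_real (x / t)))"
  let ?g = "\<lambda>t. complex_of_real t powr ((w + z) - 1) * exp (- complex_of_real t)"
  let ?K = "\<lambda>x. complex_of_real x powr (w - 1) * (complex_of_real x powr (z / 2) * Macdonald_K z (2 * sqrt x))"
  note g = Gamma_set_integral[OF assms(2)]
  have cont: "continuous_on ({0<..} \<times> {0<..}) (\<lambda>(t, x). ?f t x)"
    unfolding case_prod_beta by (auto intro!: continuous_intros)
  have inner: "set_integrable lborel {0<..} (?f t)" if "t \<in> {0<..}" for t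
    using scaled_Gamma_set_integral(1)[of w t] assms that by simp
  have norm_eq: "(LINT x:{0<..}|lborel. norm (?f t x)) = Gamma (Re w) * norm (?g t)" if "t \<in> {0<..}" for t
  proof -
    have "(LINT x:{0<..}|lborel. norm (?f t x)) = norm (complex_of_real t powr (z - 1) * exp (- complex_of_real t)) *
        (t powr Re w * Gamma (Re w))"
      unfolding norm_mult[of "_ * _" "_ * _"] set_integral_mult_right
      using scaled_Gamma_set_integral(3)[of w t] assms that by simp
    also have "\<dots> = Gamma (Re w) * norm (?g t)"
      using that by (simp add: norm_mult norm_divide norm_of_real_powr powr_add powr_diff)
    finally show ?thesis .
  qed
  have outer: "set_integrable lborel {0<..} (\<lambda>t. LINT x:{0<..}|lborel. norm (?f t x))"
    using set_integrable_norm[OF g(1)] by (subst set_integrable_cong[OF refl refl norm_eq]) auto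
  have val: "(LINT x:{0<..}|lborel. ?f t x) = Gamma w * ?g t" if "t \<in> {0<..}" for t
    unfolding set_integral_mult_right scaled_Gamma_set_integral(2)[OF assms(1) that[unfolded greaterThan_iff]]
    using that by (simp add: powr_add powr_diff)
  have K: "(LINT t:{0<..}|lborel. ?f t x) = 2 * ?K x" if "x \<in> {0<..}" for x
  proof -
    have "(LINT t:{0<..}|lborel. ?f t x) = (LINT t:{0<..}|lborel. complex_of_real x powr (w - 1) *
       (complex_of_real t powr (z - 1) * exp (- complex_of_real (t + x / t))))"
      by (rule set_lebesgue_integral_cong) (simp_all add: mult_ac flip: exp_add)
    also have "\<dots> = complex_of_real x powr (w - 1) * (2 * (complex_of_real x powr (z / 2) * Macdonald_K z (2 * sqrt x)))"
      using Macdonald_K_eq_kernel_integral[of x z] that by simp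
    finally show ?thesis by simp
  qed
  note fub = set_Fubini_continuous[OF _ _ cont inner outer]
  have "set_integrable lborel {0<..} (\<lambda>x. 2 * ?K x)"
    using fub(1) by (subst set_integrable_cong[OF refl refl K[symmetric]]) auto
  then show "set_integrable lborel {0<..} ?K" by simp
  have "2 * (LINT x:{0<..}|lborel. ?K x) = (LINT x:{0<..}|lborel. LINT t:{0<..}|lborel. ?f t x)"
    by (subst set_lebesgue_integral_cong[OF _ _ ]) (use K in auto)
  also have "\<dots> = (LINT t:{0<..}|lborel. LINT x:{0<..}|lborel. ?f t x)"
    by (rule fub(2)) auto
  also have "\<dots> = (LINT t:{0<..}|lborel. Gamma w * ?g t)"
    by (rule set_lebesgue_integral_cong, simp, intro allI impI, rule val)
  finally show "2 * (LINT x:{0<..}|lborel. ?K x) = Gamma w * Gamma (w + z)"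
    using g(2) by simp
qed

section \<open>The transformation F\<close>

text \<open>
  All three claims come out of one application of Fubini's theorem to the function
  \<open>H(x, t) = x\<^bsup>z/2\<^esup> K\<^sub>z(2 \<surd>x) x\<^sup>-\<^sup>s f\<^sup>*(s)\<close> with \<open>s = c0 + i t\<close>: one iterated integral is
  \<open>\<pi> F f(z)\<close>, the other a multiple of the integral of the Gamma factors.
\<close>

lemma F_transform_Gamma_representation:
  assumes c0: "c0 < 1" and g: "vline_integrable c0 g"
    and f: "\<And>x. x > 0 \<Longrightarrow> f x = inverse_mellin c0 g x"
    and z: "Re z > c0 - 1"
  shows "set_integrable lborel {0<..} (F_integrand f z)"
    and "vline_integrable c0 (\<lambda>s. Gamma (1 - s + z) * Gamma (1 - s) * g s)"
    and "F_transform f z = 1 / (2 * complex_of_real pi * \<i>) *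
            vline_integral c0 (\<lambda>s. Gamma (1 - s + z) * Gamma (1 - s) * g s)"
proof -
  define B where "B x = complex_of_real x powr (z / 2) * Macdonald_K z (2 * sqrt x)" for x
  define G where "G t = g (Complex c0 t)" for t
  \<comment> \<open>\<open>P\<close> carries the whole modulus in \<open>x\<close>; the rest of \<open>x\<^sup>-\<^sup>s\<close> is the unimodular factor
    \<open>exp (- i t ln x)\<close>, which makes \<open>H\<close> visibly measurable and its modulus a product.\<close>
  define P where "P x = indicat_real {0<..} x *\<^sub>R (complex_of_real x powr (complex_of_real (- c0)) * B x)" for x
  define H where "H x t = P x * (exp (- (\<i> * complex_of_real (t * ln x))) * G t)" for x t
  have G: "integrable lborel G" using g by (simp add: G_def[abs_def] vline_integrable_def)
  have P: "integrable lborel P"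
    using Mellin_transform_kernel(1)[of "1 - complex_of_real c0" z] c0 z
    unfolding P_def[abs_def] B_def set_integrable_def by simp
  note [measurable] = borel_measurable_integrable[OF G, simplified] borel_measurable_integrable[OF P, simplified]
  have norm_H: "norm (H x t) = norm (P x) * norm (G t)" for x t
    by (simp add: H_def norm_mult)
  have H_eq: "H x t = indicat_real {0<..} x *\<^sub>R (B x * (G t * complex_of_real x powr (- Complex c0 t)))" for x t
  proof (cases "x > 0")
    case True
    have "- Complex c0 t = complex_of_real (- c0) + - (\<i> * complex_of_real t)"
      by (simp add: complex_eq_iff)
    then have "complex_of_real x powr (- Complex c0 t)
      = complex_of_real x powr (complex_of_real (- c0)) * complex_of_real x powr (- (\<i> * complex_of_real t))"
      using powr_add by metis
    also have "complex_of_real x powr (- (\<i> * complex_of_real t)) = exp (- (\<i> * complex_of_real (t * ln x)))"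
      using True by (simp add: powr_def Ln_of_real' mult_ac)
    finally show ?thesis using True by (simp add: H_def P_def)
  qed (simp add: H_def P_def)
  have [measurable]: "(\<lambda>(x, t). H x t) \<in> borel_measurable (lborel \<Otimes>\<^sub>M lborel)"
    unfolding H_def by measurable
  have int: "integrable (lborel \<Otimes>\<^sub>M lborel) (\<lambda>(x, t). H x t)"
  proof (rule lborel_pair.Fubini_integrable)
    show "integrable lborel (\<lambda>x. LINT t|lborel. norm (case (x, t) of (x, t) \<Rightarrow> H x t))"
      using P by (simp add: norm_H)
    have "integrable lborel (H x)" for x
      by (rule Bochner_Integration.integrable_bound[where f="\<lambda>t. P x * G t"])
         (use G in \<open>auto simp: norm_H norm_mult\<close>)
    then show "AE x in lborel. integrable lborel (\<lambda>t. case (x, t) of (x, t) \<Rightarrow> H x t)" by simp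
  qed simp
  have in1: "(LINT t|lborel. H x t) = (2 * pi) *\<^sub>R (indicat_real {0<..} x *\<^sub>R F_integrand f z x)" for x
  proof (cases "x > 0")
    case True
    have "(LINT t|lborel. H x t) = B x * (LINT t|lborel. G t * complex_of_real x powr (- Complex c0 t))"
      unfolding H_eq using True by simp
    also have "(LINT t|lborel. G t * complex_of_real x powr (- Complex c0 t)) = 2 * pi * f x"
      by (simp add: f[OF True] inverse_mellin_def vline_integral_def G_def)
    finally show ?thesis
      using True by (simp add: F_integrand_def B_def scaleR_conv_of_real)
  qed (simp add: H_eq)
  have in2: "(LINT x|lborel. H x t) = (Gamma (1 - Complex c0 t + z) * Gamma (1 - Complex c0 t) * G t) / 2" for t
  proof -
    have "(LINT x|lborel. H x t) = (LINT x:{0<..}|lborel. G t * (complex_of_real x powr ((1 - Complex c0 t) - 1) * B x))"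
      unfolding H_eq set_lebesgue_integral_def by (simp add: mult_ac)
    also have "\<dots> = G t * (LINT x:{0<..}|lborel. complex_of_real x powr ((1 - Complex c0 t) - 1) * B x)"
      by (rule set_integral_mult_right)
    also have "2 * \<dots> = G t * (Gamma (1 - Complex c0 t) * Gamma (1 - Complex c0 t + z))"
      using Mellin_transform_kernel(2)[of "1 - Complex c0 t" z] c0 z unfolding B_def
      by (simp add: mult_ac)
    finally show ?thesis by (simp add: mult_ac)
  qed
  show "set_integrable lborel {0<..} (F_integrand f z)"
    using integrable_scaleR_right[of "1 / (2 * pi)", OF lborel_pair.integrable_fst[OF int]]
    unfolding in1 set_integrable_def by simp
  show "vline_integrable c0 (\<lambda>s. Gamma (1 - s + z) * Gamma (1 - s) * g s)"
    using integrable_mult_right[of 2, OF lborel_pair.integrable_snd[OF int]]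
    unfolding in2 vline_integrable_def G_def by simp
  have "(2 * pi) *\<^sub>R (LINT x:{0<..}|lborel. F_integrand f z x)
     = (LINT t|lborel. Gamma (1 - Complex c0 t + z) * Gamma (1 - Complex c0 t) * G t) / 2"
    using lborel_pair.Fubini_integral[OF int] unfolding in1 in2 integral_scaleR_right
    by (simp add: set_lebesgue_integral_def)
  then show "F_transform f z = 1 / (2 * complex_of_real pi * \<i>) *
            vline_integral c0 (\<lambda>s. Gamma (1 - s + z) * Gamma (1 - s) * g s)"
    by (simp add: F_transform_def vline_integral_def G_def scaleR_conv_of_real field_simps)
qed

text \<open>
  Near a given point, the real number \<open>Re (1 - s + z) = 1 - c0 + Re z\<close> stays in a compact
  interval of positive numbers, on which the real Gamma function is bounded. This gives the
  majorant needed to differentiate the Gamma representation under the integral.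
\<close>

lemma F_transform_holomorphic:
  assumes c0: "c0 < 1" and g: "vline_integrable c0 g"
    and f: "\<And>x. x > 0 \<Longrightarrow> f x = inverse_mellin c0 g x"
  shows "F_transform f holomorphic_on {z. Re z > c0 - 1}"
proof -
  let ?S = "{z. Re z > c0 - 1}"
  let ?h = "\<lambda>z t. Gamma (1 - Complex c0 t + z) * Gamma (1 - Complex c0 t) * g (Complex c0 t)"
  note rep = F_transform_Gamma_representation[OF c0 g f]
  have "(\<lambda>z. LINT t|lborel. ?h z t) holomorphic_on ?S"
  proof (rule holomorphic_on_integral_param)
    show "open ?S" by (rule open_halfspace_Re_gt)
    show "(\<lambda>z. ?h z t) holomorphic_on ?S" for t
      by (auto intro!: holomorphic_intros elim!: nonpos_Ints_cases simp: complex_eq_iff)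
    show "integrable lborel (?h z)" if "z \<in> ?S" for z
      using rep(2) that unfolding vline_integrable_def by auto
    fix z assume z: "z \<in> ?S"
    define r where "r = (Re z - (c0 - 1)) / 2"
    define I where "I = {1 - c0 + Re z - r..1 - c0 + Re z + r}"
    have r: "r > 0" "1 - c0 + Re z - r > 0" using z by (auto simp: r_def field_simps)
    have "continuous_on I (Gamma :: real \<Rightarrow> real)"
      using r by (intro continuous_on_Gamma) (auto simp: I_def elim!: nonpos_Ints_cases)
    then have "bounded (Gamma ` I)"
      by (intro compact_imp_bounded compact_continuous_image) (auto simp: I_def)
    then obtain C where C: "\<And>x. x \<in> I \<Longrightarrow> norm (Gamma x) \<le> C" unfolding bounded_iff by auto
    have "norm (?h w t) \<le> C * Gamma (1 - c0) * norm (g (Complex c0 t))" if w: "w \<in> ball z r" for w t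
    proof -
      have "\<bar>Re w - Re z\<bar> < r"
        using w abs_Re_le_cmod[of "w - z"] by (simp add: dist_norm norm_minus_commute)
      then have *: "1 - c0 + Re w \<in> I" by (auto simp: I_def)
      then have "0 < 1 - c0 + Re w" using r by (auto simp: I_def)
      then have "norm (Gamma (1 - Complex c0 t + w)) \<le> C"
        using norm_Gamma_le[of "1 - Complex c0 t + w"] C[OF *] by simp
      moreover have "norm (Gamma (1 - Complex c0 t)) \<le> Gamma (1 - c0)"
        using norm_Gamma_le[of "1 - Complex c0 t"] c0 by simp
      ultimately have "norm (Gamma (1 - Complex c0 t + w)) * norm (Gamma (1 - Complex c0 t)) \<le> C * Gamma (1 - c0)"
        by (intro mult_mono) (auto intro: order_trans[OF norm_ge_zero])
      then show ?thesis
        unfolding norm_mult by (rule mult_right_mono) simp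
    qed
    moreover have "integrable lborel (\<lambda>t. C * Gamma (1 - c0) * norm (g (Complex c0 t)))"
      using g by (simp add: vline_integrable_def)
    ultimately show "\<exists>r>0. \<exists>B. integrable lborel B \<and> (\<forall>w\<in>ball z r \<inter> ?S. \<forall>t\<in>space lborel. norm (?h w t) \<le> B t)"
      using r(1) by blast
  qed
  then have "(\<lambda>z. (LINT t|lborel. ?h z t) / (2 * complex_of_real pi)) holomorphic_on ?S"
    by (intro holomorphic_intros) auto
  then show ?thesis
    by (rule holomorphic_transform) (use rep(3) in \<open>auto simp: vline_integral_def field_simps\<close>)
qed

text \<open>
  For \<open>z = \<sigma> + i \<tau>\<close> and \<open>s = c0 + i t\<close> the factor \<open>\<Gamma>(1 - s + z)\<close> depends on \<open>\<tau> - t\<close> only, so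
  the Gamma representation is a convolution, and the \<open>L\<^sub>1\<close> norm of a convolution is at most the
  product of the \<open>L\<^sub>1\<close> norms. The other factor \<open>\<Gamma>(1 - s) f\<^sup>*(s)\<close> has norm at most
  \<open>\<Gamma>(1 - c0)\<close> times that of \<open>f\<^sup>*\<close>.
\<close>

lemma F_transform_L1_bound:
  assumes c0: "c0 < 1" and g: "vline_integrable c0 g"
    and f: "\<And>x. x > 0 \<Longrightarrow> f x = inverse_mellin c0 g x"
    and \<sigma>: "\<sigma> > c0 - 1"
  shows "vline_integrable \<sigma> (F_transform f)"
    and "vline_L1_norm \<sigma> (F_transform f) \<le>
      Gamma (1 - c0) * (LINT \<tau>|lborel. norm (Gamma (Complex (1 - c0 + \<sigma>) \<tau>))) * (1 / (2 * pi) * vline_L1_norm c0 g)"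
proof -
  define \<gamma> where "\<gamma> \<tau> = Gamma (Complex (1 - c0 + \<sigma>) \<tau>)" for \<tau>
  define J where "J = (LINT \<tau>|lborel. norm (\<gamma> \<tau>))"
  define k where "k t = Gamma (1 - Complex c0 t) * g (Complex c0 t)" for t
  define Q where "Q t \<tau> = \<gamma> (\<tau> - t) * k t" for t \<tau>
  have G: "integrable lborel (\<lambda>t. g (Complex c0 t))" using g by (simp add: vline_integrable_def)
  have J: "J \<ge> 0" by (simp add: J_def)
  have \<gamma>: "integrable lborel \<gamma>" unfolding \<gamma>_def[abs_def] using \<sigma> by (intro Gamma_vertical_integrable) simp
  have \<gamma>_shift: "integrable lborel (\<lambda>\<tau>. \<gamma> (\<tau> - t))" "(LINT \<tau>|lborel. norm (\<gamma> (\<tau> - t))) = J" for t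
    using lborel_integrable_real_affine[OF \<gamma>, of 1 "- t"] lborel_integral_real_affine[of 1 "\<lambda>\<tau>. norm (\<gamma> \<tau>)" "- t"]
    by (simp_all add: J_def add.commute)
  have norm_k: "norm (k t) \<le> Gamma (1 - c0) * norm (g (Complex c0 t))" for t
    using norm_Gamma_le[of "1 - Complex c0 t"] c0 by (simp add: k_def norm_mult mult_right_mono)
  have eq: "1 - Complex c0 t = Complex (1 - c0) (0 + (-1) * t)" for t by (simp add: complex_eq_iff)
  have "integrable lborel (\<lambda>t. Gamma (1 - Complex c0 t))"
    unfolding eq using Gamma_vertical_integrable[of "1 - c0"] c0
    by (intro lborel_integrable_real_affine) auto
  note [measurable] = borel_measurable_integrable[OF this, simplified] borel_measurable_integrable[OF G, simplified]
    borel_measurable_integrable[OF \<gamma>, simplified]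
  have mk[measurable]: "k \<in> borel_measurable borel" unfolding k_def by measurable
  have k: "integrable lborel k"
    by (rule Bochner_Integration.integrable_bound[where f="\<lambda>t. Gamma (1 - c0) * norm (g (Complex c0 t))"])
       (use G norm_k in \<open>auto intro: order_trans[OF _ abs_ge_self]\<close>)
  have [measurable]: "(\<lambda>(t, \<tau>). Q t \<tau>) \<in> borel_measurable (lborel \<Otimes>\<^sub>M lborel)"
    unfolding Q_def by measurable
  have nQ: "(LINT \<tau>|lborel. norm (Q t \<tau>)) = J * norm (k t)" for t
    using \<gamma>_shift by (simp add: Q_def norm_mult)
  have int: "integrable (lborel \<Otimes>\<^sub>M lborel) (\<lambda>(t, \<tau>). Q t \<tau>)"
  proof (rule lborel_pair.Fubini_integrable)
    show "integrable lborel (\<lambda>t. LINT \<tau>|lborel. norm (case (t, \<tau>) of (t, \<tau>) \<Rightarrow> Q t \<tau>))"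
      using k by (simp add: nQ)
    show "AE t in lborel. integrable lborel (\<lambda>\<tau>. case (t, \<tau>) of (t, \<tau>) \<Rightarrow> Q t \<tau>)"
      using \<gamma>_shift(1) by (simp add: Q_def)
  qed simp
  have intn: "integrable (lborel \<Otimes>\<^sub>M lborel) (\<lambda>(t, \<tau>). norm (Q t \<tau>))"
    using integrable_norm[OF int] by (simp add: case_prod_beta')
  have F: "F_transform f (Complex \<sigma> \<tau>) = (LINT t|lborel. Q t \<tau>) / (2 * complex_of_real pi)" for \<tau>
  proof -
    have "1 - Complex c0 t + Complex \<sigma> \<tau> = Complex (1 - c0 + \<sigma>) (\<tau> - t)" for t by (simp add: complex_eq_iff)
    then show ?thesis
      using F_transform_Gamma_representation(3)[OF c0 g f, of "Complex \<sigma> \<tau>"] \<sigma>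
      by (simp add: vline_integral_def Q_def k_def \<gamma>_def mult_ac)
  qed
  show "vline_integrable \<sigma> (F_transform f)"
    unfolding vline_integrable_def F using lborel_pair.integrable_snd[OF int] by simp
  have "(LINT \<tau>|lborel. norm (LINT t|lborel. Q t \<tau>)) \<le> (LINT \<tau>|lborel. LINT t|lborel. norm (Q t \<tau>))"
    using integrable_norm[OF lborel_pair.integrable_snd[OF int]] lborel_pair.integrable_snd[OF intn]
    by (rule integral_mono) (rule integral_norm_bound)
  also have "\<dots> = J * (LINT t|lborel. norm (k t))"
    using lborel_pair.Fubini_integral[OF intn] by (simp add: nQ)
  also have "\<dots> \<le> J * (LINT t|lborel. Gamma (1 - c0) * norm (g (Complex c0 t)))"
    by (intro mult_left_mono[OF _ J] integral_mono) (use k G norm_k in auto)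
  also have "\<dots> = J * (Gamma (1 - c0) * vline_L1_norm c0 g)"
    by (simp add: vline_L1_norm_def)
  finally have "(LINT \<tau>|lborel. norm (LINT t|lborel. Q t \<tau>)) / (2 * pi) \<le> J * (Gamma (1 - c0) * vline_L1_norm c0 g) / (2 * pi)"
    by (rule divide_right_mono) simp
  moreover have "vline_L1_norm \<sigma> (F_transform f) = (LINT \<tau>|lborel. norm (LINT t|lborel. Q t \<tau>)) / (2 * pi)"
    unfolding vline_L1_norm_def F by (simp add: norm_divide norm_mult)
  ultimately show "vline_L1_norm \<sigma> (F_transform f) \<le>
      Gamma (1 - c0) * (LINT \<tau>|lborel. norm (Gamma (Complex (1 - c0 + \<sigma>) \<tau>))) * (1 / (2 * pi) * vline_L1_norm c0 g)"
    by (simp add: J_def \<gamma>_def mult_ac)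
qed

lemma F_transform_linear:
  assumes "set_integrable lborel {0<..} (F_integrand g z)" "set_integrable lborel {0<..} (F_integrand h z)"
  shows "F_transform (\<lambda>x. a * g x + b * h x) z = a * F_transform g z + b * F_transform h z"
proof -
  have "F_integrand (\<lambda>x. a * g x + b * h x) z = (\<lambda>x. a * F_integrand g z x + b * F_integrand h z x)"
    by (simp add: F_integrand_def fun_eq_iff algebra_simps)
  then show ?thesis
    using assms by (simp add: F_transform_def set_integral_add algebra_simps)
qed

theorem theorem1:
  fixes c0 :: real and f :: "real \<Rightarrow> complex" and fstar :: "complex \<Rightarrow> complex"
  assumes "c0 < 1"
    and "vline_integrable c0 fstar"
    and "\<And>x. x > 0 \<Longrightarrow> f x = inverse_mellin c0 fstar x"
  shows "(\<forall>z. Re z > c0 - 1 \<longrightarrow> set_integrable lborel {0<..} (F_integrand f z))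
    \<and> F_transform f analytic_on {z. Re z > c0 - 1}
    \<and> (\<forall>z. Re z > c0 - 1 \<longrightarrow>
          vline_integrable c0 (\<lambda>s. Gamma (1 - s + z) * Gamma (1 - s) * fstar s)
        \<and> F_transform f z = 1 / (2 * complex_of_real pi * \<i>) *
            vline_integral c0 (\<lambda>s. Gamma (1 - s + z) * Gamma (1 - s) * fstar s))
    \<and> (\<forall>\<sigma>. \<sigma> > c0 - 1 \<longrightarrow>
          (\<forall>h\<in>inverse_mellin_space c0. vline_integrable \<sigma> (F_transform h))
        \<and> (\<forall>g\<in>inverse_mellin_space c0. \<forall>h\<in>inverse_mellin_space c0. \<forall>a b z. Re z = \<sigma> \<longrightarrow>
              F_transform (\<lambda>x. a * g x + b * h x) z = a * F_transform g z + b * F_transform h z)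
        \<and> bounded_operator (inverse_mellin_space c0) (inverse_mellin_norm c0)
            (vline_L1_norm \<sigma>) F_transform
        \<and> integrable lborel (\<lambda>\<tau>. norm (Gamma (Complex (1 - c0 + \<sigma>) \<tau>)))
        \<and> operator_norm (inverse_mellin_space c0) (inverse_mellin_norm c0)
              (vline_L1_norm \<sigma>) F_transform
            \<le> Gamma (1 - c0) * (LINT \<tau>|lborel. norm (Gamma (Complex (1 - c0 + \<sigma>) \<tau>))))"
proof (intro conjI allI impI ballI)
  note rep = F_transform_Gamma_representation[OF assms]
  show "set_integrable lborel {0<..} (F_integrand f z)" if "Re z > c0 - 1" for z
    by (rule rep(1)[OF _ that])
  show "F_transform f analytic_on {z. Re z > c0 - 1}"
    using F_transform_holomorphic[OF assms] by (simp add: analytic_on_open open_halfspace_Re_gt)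
  show "vline_integrable c0 (\<lambda>s. Gamma (1 - s + z) * Gamma (1 - s) * fstar s)" if "Re z > c0 - 1" for z
    by (rule rep(2)[OF _ that])
  show "F_transform f z = 1 / (2 * complex_of_real pi * \<i>) *
            vline_integral c0 (\<lambda>s. Gamma (1 - s + z) * Gamma (1 - s) * fstar s)" if "Re z > c0 - 1" for z
    by (rule rep(3)[OF _ that])
next
  fix \<sigma> assume \<sigma>: "\<sigma> > c0 - 1"
  let ?C = "Gamma (1 - c0) * (LINT \<tau>|lborel. norm (Gamma (Complex (1 - c0 + \<sigma>) \<tau>)))"
  have some: "inverse_mellin_rep c0 h (SOME g. inverse_mellin_rep c0 h g)"
    if "h \<in> inverse_mellin_space c0" for h
    using that unfolding inverse_mellin_space_def by (auto intro: someI[of "inverse_mellin_rep c0 h"])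
  show "vline_integrable \<sigma> (F_transform h)" if "h \<in> inverse_mellin_space c0" for h
    using F_transform_L1_bound(1)[OF \<open>c0 < 1\<close> _ _ \<sigma>] some[OF that]
    unfolding inverse_mellin_rep_def by blast
  show "F_transform (\<lambda>x. a * g x + b * h x) z = a * F_transform g z + b * F_transform h z"
    if "g \<in> inverse_mellin_space c0" "h \<in> inverse_mellin_space c0" "Re z = \<sigma>" for g h a b z
  proof (rule F_transform_linear)
    have "set_integrable lborel {0<..} (F_integrand k z)" if "k \<in> inverse_mellin_space c0" for k
      using F_transform_Gamma_representation(1)[OF \<open>c0 < 1\<close>, of _ k z] some[OF that] \<sigma> \<open>Re z = \<sigma>\<close>
      unfolding inverse_mellin_rep_def by blast
    then show "set_integrable lborel {0<..} (F_integrand g z)" "set_integrable lborel {0<..} (F_integrand h z)"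
      using that by blast+
  qed
  have bound: "vline_L1_norm \<sigma> (F_transform h) \<le> ?C * inverse_mellin_norm c0 h"
    if "h \<in> inverse_mellin_space c0" for h
    using F_transform_L1_bound(2)[OF \<open>c0 < 1\<close> _ _ \<sigma>] some[OF that]
    unfolding inverse_mellin_rep_def inverse_mellin_norm_def by blast
  have C: "?C \<ge> 0"
    using Gamma_real_pos[of "1 - c0"] \<open>c0 < 1\<close> by simp
  show "bounded_operator (inverse_mellin_space c0) (inverse_mellin_norm c0) (vline_L1_norm \<sigma>) F_transform"
    unfolding bounded_operator_def using C bound by blast
  show "integrable lborel (\<lambda>\<tau>. norm (Gamma (Complex (1 - c0 + \<sigma>) \<tau>)))"
    using Gamma_vertical_integrable[of "1 - c0 + \<sigma>"] \<sigma> by simp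
  show "operator_norm (inverse_mellin_space c0) (inverse_mellin_norm c0) (vline_L1_norm \<sigma>) F_transform \<le> ?C"
    unfolding operator_norm_def
    by (rule cInf_lower) (use C bound in \<open>auto intro!: bdd_belowI[of _ 0]\<close>)
qed

end
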